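(* Let $1<p<\infty$, let $N>M>p$ with $N,M$ integers, let $\omega$ be a domain in $\mathbb{R}^{N-M}$ and let $\Omega:=\omega\times\mathbb{R}^M$. Then $$\lambda_{1,p}(\Omega)=\lambda_{1,p}(\omega).$$
   Context: For a domain $G$ in a Euclidean space, $\lambda_{1,p}(G):=\inf\left\{\int_G|\nabla u|^p\,dx : u\in\mathcal{D}(G),\ \int_G|u|^p\,dx=1\right\}$, where $\mathcal{D}(G)$ is the space of (real-valued) test functions on $G$. *)

theory Defs
  imports "HOL-Analysis.Analysis"
begin

definition domain_set :: "'a::euclidean_space set \<Rightarrow> bool"
  where "domain_set G \<longleftrightarrow> G \<noteq> {} \<and> open G \<and> connected G"

text \<open>Class \<open>C\<^sup>k\<close> on the whole space, by recursion on \<open>k\<close>: \<open>u\<close> is (Frechet) differentiable and all its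
  directional derivatives are of class \<open>C\<^sup>k\<^sup>-\<^sup>1\<close>.\<close>

fun C_k :: "nat \<Rightarrow> ('a::euclidean_space \<Rightarrow> real) \<Rightarrow> bool"
  where
    "C_k 0 u \<longleftrightarrow> continuous_on UNIV u"
  | "C_k (Suc k) u \<longleftrightarrow>
      (\<forall>x. u differentiable (at x)) \<and> (\<forall>v. C_k k (\<lambda>x. frechet_derivative u (at x) v))"

text \<open>A test function on an open set \<open>G\<close> is represented by its extension by zero, a smooth function
  on the whole space whose support is a compact subset of \<open>G\<close>.\<close>

definition test_functions :: "'a::euclidean_space set \<Rightarrow> ('a \<Rightarrow> real) set"
  where "test_functions G =
    {u. (\<forall>k. C_k k u) \<and> compact (closure {x. u x \<noteq> 0}) \<and> closure {x. u x \<noteq> 0} \<subseteq> G}"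

definition gradient :: "('a::euclidean_space \<Rightarrow> real) \<Rightarrow> 'a \<Rightarrow> 'a"
  where "gradient u x = (\<Sum>i\<in>Basis. frechet_derivative u (at x) i *\<^sub>R i)"

lemma GDERIV_gradient:
  assumes "u differentiable (at x)"
  shows "GDERIV u x :> gradient u x"
proof -
  interpret linear "frechet_derivative u (at x)"
    using assms by (rule linear_frechet_derivative)
  have "frechet_derivative u (at x) h = inner h (gradient u x)" for h
  proof -
    have "frechet_derivative u (at x) h
        = frechet_derivative u (at x) (\<Sum>i\<in>Basis. inner h i *\<^sub>R i)"
      by (simp add: euclidean_representation)
    also have "\<dots> = inner h (gradient u x)"
      by (simp add: sum scale gradient_def inner_sum_right mult.commute)
    finally show ?thesis .
  qed
  then have "frechet_derivative u (at x) = (\<lambda>h. inner h (gradient u x))"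
    by (rule ext)
  then show ?thesis
    using assms unfolding gderiv_def by (metis frechet_derivative_works)
qed

text \<open>For \<open>G\<close> nonempty and open and \<open>p > 0\<close>, the infimum is taken over a nonempty set of nonnegative
  reals, so the real-valued \<open>Inf\<close> is the genuine infimum.\<close>

definition lambda1 :: "real \<Rightarrow> 'a::euclidean_space set \<Rightarrow> real"
  where "lambda1 p G =
    Inf {(LINT x:G|lborel. norm (gradient u x) powr p) | u.
          u \<in> test_functions G \<and> (LINT x:G|lborel. \<bar>u x\<bar> powr p) = 1}"

end

theory Submission
  imports Defs "HOL-Computational_Algebra.Polynomial"
begin

text \<open>
  Write a point of \<open>\<Omega> = \<omega> \<times> UNIV\<close> as \<open>(x, y)\<close>.

  The bound \<open>lambda1 p \<omega> \<le> lambda1 p \<Omega>\<close> (\<open>lambda1_le_lambda1_Times\<close>) comes from slicing. For a test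
  function \<open>u\<close> on \<open>\<Omega>\<close> every slice \<open>u(\<cdot>, y)\<close> is a test function on \<open>\<omega>\<close>, so it obeys the
  Rayleigh bound of \<open>\<omega>\<close>, that its mass (the integral of \<open>|u|\<^sup>p\<close>) times \<open>lambda1 p \<omega>\<close> is at most
  its energy (the integral of \<open>|\<nabla>u|\<^sup>p\<close>); integrating over \<open>y\<close> with Fubini, and discarding the \<open>y\<close>-part of the
  gradient, gives the Rayleigh bound for \<open>u\<close>.

  The bound \<open>lambda1 p \<Omega> \<le> lambda1 p \<omega>\<close> comes from the trial functions \<open>u(x) w(y)\<close>, with \<open>u\<close> and \<open>w\<close>
  of mass 1. The gradient of the product has norm at most \<open>|w| |\<nabla>u| + |u| |\<nabla>w|\<close>. Convexity of the
  \<open>p\<close>-th power with weights \<open>1 - t\<close> and \<open>t\<close> splits the energy of this sum into a multiple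
  \<open>(1 - t)\<^sup>1\<^sup>-\<^sup>p\<close> of the energy of \<open>u\<close> and a multiple \<open>t\<^sup>1\<^sup>-\<^sup>p\<close> of that of \<open>w\<close> (\<open>lambda1_Times_le\<close>).
  Since dilations spread a function on the whole space out at arbitrarily small energy per mass,
  \<open>lambda1 p UNIV = 0\<close> (\<open>lambda1_UNIV\<close>), and the second term drops out after taking the infimum
  over \<open>w\<close>. Letting \<open>t\<close> tend to 0 finishes the proof.

  Both halves bound an infimum from below, which for the real-valued \<open>Inf\<close> requires that a
  test function of mass 1 exists on every nonempty open set; the section on bump functions
  provides it.
\<close>

section \<open>Calculus of smooth functions\<close>

lemma C_k_Suc_has_derivative:
  assumes "C_k (Suc k) u"
  shows "(u has_derivative frechet_derivative u (at x)) (at x)"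
  using assms frechet_derivative_works by auto

lemma C_k_SucI:
  assumes "\<And>x. (u has_derivative D x) (at x)" and "\<And>v. C_k k (\<lambda>x. D x v)"
  shows "C_k (Suc k) u"
proof -
  have "frechet_derivative u (at x) = D x" for x
    using frechet_derivative_at[OF assms(1)] by simp
  then show ?thesis
    using assms by (auto simp: differentiable_def)
qed

lemma C_k_SucD: "C_k (Suc k) u \<Longrightarrow> C_k k u"
proof (induction k arbitrary: u)
  case 0
  then show ?case
    by (auto intro!: differentiable_imp_continuous_on simp: differentiable_on_def
        intro: differentiable_at_withinI)
qed auto

lemma C_k_const: "C_k k (\<lambda>x. c)"
proof (induction k arbitrary: c)
  case (Suc k)
  show ?case by (rule C_k_SucI[where D = "\<lambda>_ _. 0"]) (auto intro: Suc)
qed auto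

lemma C_k_add: "C_k k u \<Longrightarrow> C_k k w \<Longrightarrow> C_k k (\<lambda>x. u x + w x)"
proof (induction k arbitrary: u w)
  case (Suc k)
  show ?case
    by (rule C_k_SucI[OF has_derivative_add[OF Suc.prems[THEN C_k_Suc_has_derivative]]])
      (use Suc in auto)
qed (auto intro: continuous_on_add)

lemma C_k_mult: "C_k k u \<Longrightarrow> C_k k w \<Longrightarrow> C_k k (\<lambda>x. u x * w x)"
proof (induction k arbitrary: u w)
  case (Suc k)
  show ?case
    by (rule C_k_SucI[OF has_derivative_mult[OF Suc.prems[THEN C_k_Suc_has_derivative]]],
        intro C_k_add Suc.IH) (use Suc.prems Suc.prems[THEN C_k_SucD] in auto)
qed (auto intro: continuous_on_mult)

lemma C_k_prod:
  assumes "finite I" and "\<And>i. i \<in> I \<Longrightarrow> C_k k (u i)"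
  shows "C_k k (\<lambda>x. \<Prod>i\<in>I. u i x)"
  using assms by (induction I) (auto intro: C_k_const C_k_mult)

lemma C_k_compose_affine:
  assumes "bounded_linear L"
  shows "C_k k u \<Longrightarrow> C_k k (\<lambda>x. u (L x + c))"
proof (induction k arbitrary: u)
  case 0
  have "continuous_on UNIV (\<lambda>x. L x + c)"
    using assms by (intro continuous_on_add linear_continuous_on continuous_on_const)
  then show ?case
    using 0 continuous_on_compose2[of UNIV u UNIV "\<lambda>x. L x + c"] by simp
next
  case (Suc k)
  have L: "((\<lambda>x. L x + c) has_derivative L) (at x)" for x
    using assms by (auto intro!: derivative_eq_intros bounded_linear_imp_has_derivative)
  show ?case
    by (rule C_k_SucI[OF has_derivative_compose[OF L C_k_Suc_has_derivative[OF Suc.prems]]])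
      (use Suc in auto)
qed

section \<open>Gradients\<close>

lemma gradient_eqI:
  assumes "(u has_derivative (\<lambda>h. h \<bullet> g)) (at x)"
  shows "gradient u x = g"
proof -
  have "frechet_derivative u (at x) = (\<lambda>h. h \<bullet> g)"
    using frechet_derivative_at[OF assms] by simp
  then show ?thesis
    by (simp add: gradient_def inner_commute[of _ g] euclidean_representation)
qed

lemma C_k_Suc_has_gradient:
  assumes "C_k (Suc k) u"
  shows "(u has_derivative (\<lambda>h. h \<bullet> gradient u x)) (at x)"
  using GDERIV_gradient[of u x] assms by (auto simp: gderiv_def)

text \<open>Integrability of the energy density rests on this: a continuous function of compact support is
  integrable.\<close>

lemma continuous_on_gradient:
  assumes "C_k (Suc k) u"
  shows "continuous_on UNIV (gradient u)"
proof -
  have "continuous_on UNIV (\<lambda>x. frechet_derivative u (at x) v)" for v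
  proof -
    have "C_k k (\<lambda>x. frechet_derivative u (at x) v)"
      using assms by simp
    then show ?thesis
      by (cases k) (auto intro!: differentiable_imp_continuous_on simp: differentiable_on_def)
  qed
  then show ?thesis
    unfolding gradient_def by (intro continuous_intros) auto
qed

text \<open>A function that vanishes outside a closed set vanishes near each point of the complement, so
  its gradient has no larger support. This allows every integral over \<open>G\<close> to be replaced by one
  over the whole space.\<close>

lemma gradient_zero_off_support:
  fixes u :: "'a::euclidean_space \<Rightarrow> real"
  assumes "closed K" and "\<And>x. x \<notin> K \<Longrightarrow> u x = 0" and "x \<notin> K"
  shows "gradient u x = 0"
proof (rule gradient_eqI)
  have "((\<lambda>x::'a. 0 :: real) has_derivative (\<lambda>h. h \<bullet> 0)) (at x)"
    by simp
  then show "(u has_derivative (\<lambda>h. h \<bullet> 0)) (at x)"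
    by (rule has_derivative_transform_within_open[where s = "- K"]) (use assms in auto)
qed

lemma gradient_cmult:
  assumes "C_k (Suc k) u"
  shows "gradient (\<lambda>x. c * u x) x = c *\<^sub>R gradient u x"
  by (rule gradient_eqI)
    (auto intro!: derivative_eq_intros C_k_Suc_has_gradient[OF assms])

lemma gradient_dilation:
  assumes "C_k (Suc k) u"
  shows "gradient (\<lambda>x. u (s *\<^sub>R x)) x = s *\<^sub>R gradient u (s *\<^sub>R x)"
proof (rule gradient_eqI)
  have "((\<lambda>x. s *\<^sub>R x) has_derivative (\<lambda>h. s *\<^sub>R h)) (at x)"
    by (auto intro!: derivative_eq_intros)
  from has_derivative_compose[OF this C_k_Suc_has_gradient[OF assms]]
  show "((\<lambda>x. u (s *\<^sub>R x)) has_derivative (\<lambda>h. h \<bullet> s *\<^sub>R gradient u (s *\<^sub>R x))) (at x)"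
    by simp
qed

lemma gradient_slice:
  assumes "C_k (Suc k) u"
  shows "gradient (\<lambda>x. u (x, y)) x = fst (gradient u (x, y))"
proof (rule gradient_eqI)
  have "((\<lambda>x. (x, y)) has_derivative (\<lambda>h. (h, 0))) (at x)"
    by (auto intro!: derivative_eq_intros)
  from has_derivative_compose[OF this C_k_Suc_has_gradient[OF assms]]
  show "((\<lambda>x. u (x, y)) has_derivative (\<lambda>h. h \<bullet> fst (gradient u (x, y)))) (at x)"
    by (simp add: inner_prod_def)
qed

lemma gradient_tensor:
  assumes "C_k (Suc k) u" and "C_k (Suc l) w"
  shows "gradient (\<lambda>z. u (fst z) * w (snd z)) (x, y)
    = (w y *\<^sub>R gradient u x, u x *\<^sub>R gradient w y)"
proof (rule gradient_eqI)
  have u: "((\<lambda>z. u (fst z)) has_derivative (\<lambda>h. fst h \<bullet> gradient u x)) (at (x, y))"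
    using has_derivative_compose[OF has_derivative_fst[OF has_derivative_ident]
        C_k_Suc_has_gradient[OF assms(1)], of "(x, y)" UNIV] by simp
  have w: "((\<lambda>z. w (snd z)) has_derivative (\<lambda>h. snd h \<bullet> gradient w y)) (at (x, y))"
    using has_derivative_compose[OF has_derivative_snd[OF has_derivative_ident]
        C_k_Suc_has_gradient[OF assms(2)], of "(x, y)" UNIV] by simp
  show "((\<lambda>z. u (fst z) * w (snd z)) has_derivative
      (\<lambda>h. h \<bullet> (w y *\<^sub>R gradient u x, u x *\<^sub>R gradient w y))) (at (x, y))"
    by (rule has_derivative_eq_rhs[OF has_derivative_mult[OF u w]])
      (auto simp: inner_prod_def algebra_simps)
qed

section \<open>Test functions\<close>

lemma test_functions_C_k: "u \<in> test_functions G \<Longrightarrow> C_k k u"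
  by (simp add: test_functions_def)

text \<open>Any compact set carrying \<open>u\<close> will do in place of the exact support, which would be awkward to
  compute for slices and products.\<close>

lemma test_functionsI:
  assumes "\<And>k. C_k k u" and "compact K" and "K \<subseteq> G" and "\<And>x. x \<notin> K \<Longrightarrow> u x = 0"
  shows "u \<in> test_functions G"
proof -
  have "closure {x. u x \<noteq> 0} \<subseteq> K"
    using assms by (intro closure_minimal compact_imp_closed) auto
  moreover from this have "compact (closure {x. u x \<noteq> 0})"
    using compact_Int_closed[OF assms(2) closed_closure] by (metis inf.absorb2)
  ultimately show ?thesis
    using assms by (auto simp: test_functions_def)
qed

lemma test_functionsE:
  assumes "u \<in> test_functions G"
  obtains K where "compact K" and "K \<subseteq> G" and "\<And>x. x \<notin> K \<Longrightarrow> u x = 0"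
    and "\<And>x. x \<notin> K \<Longrightarrow> gradient u x = 0"
proof
  let ?K = "closure {x. u x \<noteq> 0}"
  show "compact ?K" "?K \<subseteq> G"
    using assms by (auto simp: test_functions_def)
  show *: "x \<notin> ?K \<Longrightarrow> u x = 0" for x
    using closure_subset[of "{x. u x \<noteq> 0}"] by auto
  show "x \<notin> ?K \<Longrightarrow> gradient u x = 0" for x
    by (rule gradient_zero_off_support[OF closed_closure *])
qed

lemma test_functions_cmult:
  assumes "u \<in> test_functions G"
  shows "(\<lambda>x. c * u x) \<in> test_functions G"
proof -
  obtain K where "compact K" "K \<subseteq> G" "\<And>x. x \<notin> K \<Longrightarrow> u x = 0"
    using assms by (rule test_functionsE) blast
  then show ?thesis
    by (intro test_functionsI[of _ K] C_k_mult C_k_const test_functions_C_k[OF assms]) auto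
qed

lemma test_functions_dilation:
  assumes "u \<in> test_functions UNIV" and "s \<noteq> 0"
  shows "(\<lambda>x. u (s *\<^sub>R x)) \<in> test_functions UNIV"
proof -
  obtain K where K: "compact K" "\<And>x. x \<notin> K \<Longrightarrow> u x = 0"
    using assms(1) by (rule test_functionsE) blast
  show ?thesis
  proof (rule test_functionsI)
    show "C_k k (\<lambda>x. u (s *\<^sub>R x))" for k
      using C_k_compose_affine[OF bounded_linear_scaleR_right, of k u s 0]
        test_functions_C_k[OF assms(1)] by simp
    show "compact ((\<lambda>x. (1 / s) *\<^sub>R x) ` K)"
      using K by (intro compact_scaling)
    show "u (s *\<^sub>R x) = 0" if "x \<notin> (\<lambda>x. (1 / s) *\<^sub>R x) ` K" for x
    proof (rule K(2), rule notI)
      assume "s *\<^sub>R x \<in> K"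
      then have "(1 / s) *\<^sub>R (s *\<^sub>R x) \<in> (\<lambda>x. (1 / s) *\<^sub>R x) ` K"
        by (rule imageI)
      then show False
        using that assms(2) by simp
    qed
  qed simp
qed

text \<open>The slice at height \<open>y\<close> of a compact set is compact, and it lies in \<open>G\<close> because the set lies in
  \<open>G \<times> H\<close>.\<close>

lemma test_functions_slice:
  assumes "u \<in> test_functions (G \<times> H)"
  shows "(\<lambda>x. u (x, y)) \<in> test_functions G"
proof -
  obtain K where K: "compact K" "K \<subseteq> G \<times> H" "\<And>z. z \<notin> K \<Longrightarrow> u z = 0"
    using assms by (rule test_functionsE) blast
  show ?thesis
  proof (rule test_functionsI)
    have "bounded_linear (\<lambda>x. (x, 0 :: 'b))"
      by (intro bounded_linear_Pair bounded_linear_ident bounded_linear_zero)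
    from C_k_compose_affine[OF this, of _ u "(0, y)"]
    show "C_k k (\<lambda>x. u (x, y))" for k
      using test_functions_C_k[OF assms] by simp
    show "compact (fst ` (K \<inter> UNIV \<times> {y}))"
      using K by (intro compact_continuous_image compact_Int_closed continuous_intros closed_Times) auto
    show "fst ` (K \<inter> UNIV \<times> {y}) \<subseteq> G"
      using K by auto
    show "u (x, y) = 0" if "x \<notin> fst ` (K \<inter> UNIV \<times> {y})" for x
      using that by (intro K(3)) force
  qed
qed

lemma test_functions_tensor:
  assumes "u \<in> test_functions G" and "w \<in> test_functions H"
  shows "(\<lambda>z. u (fst z) * w (snd z)) \<in> test_functions (G \<times> H)"
proof -
  obtain K where K: "compact K" "K \<subseteq> G" "\<And>x. x \<notin> K \<Longrightarrow> u x = 0"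
    using assms(1) by (rule test_functionsE) blast
  obtain L where L: "compact L" "L \<subseteq> H" "\<And>y. y \<notin> L \<Longrightarrow> w y = 0"
    using assms(2) by (rule test_functionsE) blast
  show ?thesis
  proof (rule test_functionsI)
    show "C_k k (\<lambda>z. u (fst z) * w (snd z))" for k
      using C_k_compose_affine[OF bounded_linear_fst, of k u 0]
        C_k_compose_affine[OF bounded_linear_snd, of k w 0] assms
      by (intro C_k_mult) (auto intro: test_functions_C_k)
    show "compact (K \<times> L)" "K \<times> L \<subseteq> G \<times> H"
      using K L by (auto intro: compact_Times)
    show "u (fst z) * w (snd z) = 0" if "z \<notin> K \<times> L" for z
      using that K(3) L(3) by (cases z) auto
  qed
qed

section \<open>Bump functions\<close>

text \<open>The functions \<open>P(1/t) e\<^sup>-\<^sup>1\<^sup>/\<^sup>t\<close>, extended by 0 to \<open>t \<le> 0\<close>. Admitting all polynomials \<open>P\<close> makes the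
  family closed under differentiation, so that smoothness follows by induction on the order.\<close>

definition flat_exp :: "real poly \<Rightarrow> real \<Rightarrow> real"
  where "flat_exp P t = (if t > 0 then poly P (1 / t) * exp (- 1 / t) else 0)"

text \<open>In terms of \<open>x = 1/t\<close> this is the fact that \<open>e\<^sup>x\<close> outgrows every polynomial.\<close>

lemma flat_exp_tendsto_0: "(flat_exp P \<longlongrightarrow> 0) (at_right 0)"
proof -
  have "((\<lambda>x. \<Sum>i\<le>degree P. coeff P i * (x ^ i / exp x)) \<longlongrightarrow> (\<Sum>i\<le>degree P. coeff P i * 0)) at_top"
    by (intro tendsto_intros tendsto_power_div_exp_0)
  then have "((\<lambda>x. poly P x * exp (- x)) \<longlongrightarrow> 0) at_top"
    by (simp add: poly_altdef sum_distrib_right exp_minus divide_inverse mult.assoc)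
  from filterlim_compose[OF this filterlim_inverse_at_top_right]
  have "((\<lambda>t. poly P (1 / t) * exp (- 1 / t)) \<longlongrightarrow> 0) (at_right 0)"
    by (simp add: divide_inverse)
  then show ?thesis
    by (rule Lim_transform_eventually) (auto simp: flat_exp_def eventually_at_filter)
qed

text \<open>For \<open>t > 0\<close> the chain rule with \<open>x = 1/t\<close> turns \<open>P(x) e\<^sup>-\<^sup>x\<close> into
  \<open>- x\<^sup>2 (P'(x) - P(x)) e\<^sup>-\<^sup>x\<close>. At 0 the right difference quotient is \<open>x P(x) e\<^sup>-\<^sup>x\<close>, again a member of
  the family, which tends to 0.\<close>

lemma flat_exp_has_derivative:
  "(flat_exp P has_field_derivative flat_exp ([:0, 0, 1:] * (P - pderiv P)) t) (at t)"
proof (cases t "0 :: real" rule: linorder_cases)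
  case less
  have "((\<lambda>t. 0) has_field_derivative 0) (at t)"
    by simp
  then have "(flat_exp P has_field_derivative 0) (at t)"
    by (rule has_field_derivative_transform_within_open[where S = "{..<0}"]) (use less in \<open>auto simp: flat_exp_def\<close>)
  then show ?thesis
    using less by (simp add: flat_exp_def)
next
  case equal
  have "((\<lambda>h. (flat_exp P h - flat_exp P 0) / (h - 0)) \<longlongrightarrow> 0) (at_right 0)"
    by (rule Lim_transform_eventually[OF flat_exp_tendsto_0[of "[:0, 1:] * P"]])
      (auto simp: flat_exp_def eventually_at_filter)
  moreover have "((\<lambda>h. (flat_exp P h - flat_exp P 0) / (h - 0)) \<longlongrightarrow> 0) (at_left 0)"
    by (rule Lim_transform_eventually[OF tendsto_const])
      (auto simp: flat_exp_def eventually_at_filter)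
  ultimately have "(flat_exp P has_field_derivative 0) (at 0)"
    unfolding has_field_derivative_iff by (simp add: filterlim_at_split)
  then show ?thesis
    using equal by (simp add: flat_exp_def)
next
  case greater
  have "((\<lambda>x. poly P x * exp (- x)) has_field_derivative
      (poly (pderiv P) x - poly P x) * exp (- x)) (at x)" for x
    by (auto intro!: derivative_eq_intros poly_DERIV simp: algebra_simps)
  moreover have "((\<lambda>t. 1 / t) has_field_derivative - (1 / t * (1 / t))) (at t)"
    using DERIV_inverse[of t UNIV] greater by (simp add: inverse_eq_divide power2_eq_square)
  ultimately have "((\<lambda>t. poly P (1 / t) * exp (- (1 / t))) has_field_derivative
      (poly (pderiv P) (1 / t) - poly P (1 / t)) * exp (- (1 / t)) * - (1 / t * (1 / t))) (at t)"
    by (rule DERIV_chain2)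
  then have "((\<lambda>t. poly P (1 / t) * exp (- 1 / t)) has_field_derivative
      flat_exp ([:0, 0, 1:] * (P - pderiv P)) t) (at t)"
    using greater by (simp add: flat_exp_def algebra_simps)
  then show ?thesis
    by (rule has_field_derivative_transform_within_open[where S = "{0<..}"])
      (use greater in \<open>auto simp: flat_exp_def\<close>)
qed

lemma C_k_flat_exp: "C_k k (flat_exp P)"
proof (induction k arbitrary: P)
  case 0
  show ?case
    using DERIV_continuous_on[of UNIV, OF flat_exp_has_derivative] by simp
next
  case (Suc k)
  show ?case
  proof (rule C_k_SucI)
    show "(flat_exp P has_derivative (\<lambda>v. flat_exp ([:0, 0, 1:] * (P - pderiv P)) t * v)) (at t)" for t
      using flat_exp_has_derivative has_field_derivative_def by blast
    show "C_k k (\<lambda>t. flat_exp ([:0, 0, 1:] * (P - pderiv P)) t * v)" for v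
      by (intro C_k_mult C_k_const Suc)
  qed
qed

text \<open>For each coordinate, \<open>e\<^sup>-\<^sup>1\<^sup>/\<^sup>t\<close> is evaluated at the distances to the two faces of the box; the
  product of these factors is nonzero exactly where all the distances are positive.\<close>

lemma bump_function:
  assumes "cbox a b \<subseteq> G"
  obtains u where "u \<in> test_functions G" and "\<And>x. u x \<noteq> 0 \<longleftrightarrow> x \<in> box a b"
proof
  let ?g = "flat_exp 1"
  let ?u = "\<lambda>x. \<Prod>i\<in>Basis. ?g (x \<bullet> i - a \<bullet> i) * ?g (b \<bullet> i - x \<bullet> i)"
  have g: "?g t \<noteq> 0 \<longleftrightarrow> 0 < t" for t
    by (simp add: flat_exp_def)
  show u: "?u x \<noteq> 0 \<longleftrightarrow> x \<in> box a b" for x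
    by (simp add: prod_zero_iff g mem_box)
  show "?u \<in> test_functions G"
  proof (rule test_functionsI)
    show "C_k k ?u" for k
    proof (intro C_k_prod C_k_mult finite_Basis)
      fix i :: 'a
      show "C_k k (\<lambda>x. ?g (x \<bullet> i - a \<bullet> i))"
        using C_k_compose_affine[OF bounded_linear_inner_left C_k_flat_exp, of k 1 i "- (a \<bullet> i)"]
        by simp
      show "C_k k (\<lambda>x. ?g (b \<bullet> i - x \<bullet> i))"
        using C_k_compose_affine[OF bounded_linear_minus[OF bounded_linear_inner_left] C_k_flat_exp,
            of k 1 i "b \<bullet> i"] by simp
    qed
    show "?u x = 0" if "x \<notin> cbox a b" for x
      using that u[of x] box_subset_cbox[of a b] by blast
  qed (use assms in auto)
qed

section \<open>The Rayleigh quotient\<close>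

definition p_energy :: "real \<Rightarrow> ('a::euclidean_space \<Rightarrow> real) \<Rightarrow> real"
  where "p_energy p u = (\<integral>x. norm (gradient u x) powr p \<partial>lborel)"

definition p_mass :: "real \<Rightarrow> ('a::euclidean_space \<Rightarrow> real) \<Rightarrow> real"
  where "p_mass p u = (\<integral>x. \<bar>u x\<bar> powr p \<partial>lborel)"

lemma p_energy_nonneg: "0 \<le> p_energy p u"
  unfolding p_energy_def by (rule integral_nonneg_AE) auto

lemma p_mass_nonneg: "0 \<le> p_mass p u"
  unfolding p_mass_def by (rule integral_nonneg_AE) auto

text \<open>Test functions and their gradients vanish off \<open>G\<close>, so the domain of integration can be dropped.
  From here on, only the class of admissible functions depends on \<open>G\<close>.\<close>

lemma lambda1_eq:
  "lambda1 p G = Inf {p_energy p u | u. u \<in> test_functions G \<and> p_mass p u = 1}"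
proof -
  have "(LINT x:G|lborel. norm (gradient u x) powr p) = p_energy p u"
    and "(LINT x:G|lborel. \<bar>u x\<bar> powr p) = p_mass p u" if u: "u \<in> test_functions G" for u
  proof -
    obtain K where "K \<subseteq> G" "\<And>x. x \<notin> K \<Longrightarrow> u x = 0" "\<And>x. x \<notin> K \<Longrightarrow> gradient u x = 0"
      using u by (rule test_functionsE) blast
    then have "u x = 0" "gradient u x = 0" if "x \<notin> G" for x
      using that by blast+
    then show "(LINT x:G|lborel. norm (gradient u x) powr p) = p_energy p u"
      and "(LINT x:G|lborel. \<bar>u x\<bar> powr p) = p_mass p u"
      unfolding set_lebesgue_integral_def p_energy_def p_mass_def
      by (auto intro!: Bochner_Integration.integral_cong simp: indicator_def)
  qed
  then have "{(LINT x:G|lborel. norm (gradient u x) powr p) | u.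
      u \<in> test_functions G \<and> (LINT x:G|lborel. \<bar>u x\<bar> powr p) = 1}
    = {p_energy p u | u. u \<in> test_functions G \<and> p_mass p u = 1}"
    by (intro Collect_cong) metis
  then show ?thesis
    unfolding lambda1_def by simp
qed

lemma integrable_continuous_compact_support:
  fixes f :: "'a::euclidean_space \<Rightarrow> real"
  assumes "continuous_on UNIV f" and "compact K" and "\<And>x. x \<notin> K \<Longrightarrow> f x = 0"
  shows "integrable lborel f"
proof -
  have "integrable lborel (\<lambda>x. indicator K x *\<^sub>R f x)"
    using assms by (intro borel_integrable_compact continuous_on_subset[OF assms(1)]) auto
  also have "(\<lambda>x. indicator K x *\<^sub>R f x) = f"
    using assms(3) by (force simp: indicator_def)
  finally show ?thesis .
qed

lemma integrable_test_function_powr: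
  assumes "u \<in> test_functions G" and "0 < p"
  shows "integrable lborel (\<lambda>x. \<bar>u x\<bar> powr p)"
proof -
  obtain K where K: "compact K" "\<And>x. x \<notin> K \<Longrightarrow> u x = 0"
    using assms(1) by (rule test_functionsE) blast
  have "continuous_on UNIV u"
    using test_functions_C_k[OF assms(1), of 0] by simp
  then show ?thesis
    using K assms(2)
    by (intro integrable_continuous_compact_support[of _ K] continuous_on_powr' continuous_intros) auto
qed

text \<open>The linear map \<open>L\<close> allows for the partial gradients that arise from slicing, where it is a
  projection.\<close>

lemma integrable_linear_gradient_powr:
  assumes "u \<in> test_functions G" and "0 < p" and "bounded_linear L"
  shows "integrable lborel (\<lambda>x. norm (L (gradient u x)) powr p)"
proof -
  interpret bounded_linear L by fact
  obtain K where K: "compact K" "\<And>x. x \<notin> K \<Longrightarrow> gradient u x = 0"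
    using assms(1) by (rule test_functionsE) blast
  have "continuous_on UNIV (\<lambda>x. L (gradient u x))"
    using continuous_on[OF continuous_on_gradient] test_functions_C_k[OF assms(1)] by blast
  then show ?thesis
    using K assms(2)
    by (intro integrable_continuous_compact_support[of _ K] continuous_on_powr' continuous_intros)
      (auto simp: zero)
qed

lemmas integrable_gradient_powr = integrable_linear_gradient_powr[OF _ _ bounded_linear_ident]

lemma p_mass_cmult: "p_mass p (\<lambda>x. c * u x) = \<bar>c\<bar> powr p * p_mass p u"
  by (simp add: p_mass_def abs_mult powr_mult)

lemma p_energy_cmult:
  assumes "u \<in> test_functions G"
  shows "p_energy p (\<lambda>x. c * u x) = \<bar>c\<bar> powr p * p_energy p u"
  by (simp add: p_energy_def gradient_cmult[OF test_functions_C_k[OF assms]] powr_mult)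

lemma normalise_p_mass:
  assumes "p_mass p u \<noteq> 0" and "0 < p"
  obtains c where "p_mass p (\<lambda>x. c * u x) = 1" and "\<bar>c\<bar> powr p = 1 / p_mass p u"
proof
  let ?c = "p_mass p u powr (- 1 / p)"
  have "0 < p_mass p u"
    using assms(1) p_mass_nonneg[of p u] by linarith
  then show *: "\<bar>?c\<bar> powr p = 1 / p_mass p u"
    using assms(2) by (simp add: powr_powr powr_neg_one)
  show "p_mass p (\<lambda>x. ?c * u x) = 1"
    unfolding p_mass_cmult * using assms(1) by simp
qed

text \<open>The homogeneous form of the Rayleigh bound, valid also for functions of mass 0. Slices of a
  normalised function have arbitrary mass, possibly 0.\<close>

lemma lambda1_mult_p_mass_le:
  assumes "u \<in> test_functions G" and "0 < p"
  shows "lambda1 p G * p_mass p u \<le> p_energy p u"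
proof (cases "p_mass p u = 0")
  case False
  then obtain c where c: "p_mass p (\<lambda>x. c * u x) = 1" "\<bar>c\<bar> powr p = 1 / p_mass p u"
    using assms(2) by (rule normalise_p_mass)
  have "lambda1 p G \<le> p_energy p (\<lambda>x. c * u x)"
    unfolding lambda1_eq
    by (rule cInf_lower) (use c test_functions_cmult[OF assms(1)] in
        \<open>auto intro!: bdd_belowI[of _ 0] p_energy_nonneg\<close>)
  also have "\<dots> = p_energy p u / p_mass p u"
    by (simp add: p_energy_cmult[OF assms(1)] c)
  finally show ?thesis
    using False p_mass_nonneg[of p u] by (simp add: pos_le_divide_eq)
qed (simp add: p_energy_nonneg)

text \<open>The infimum is bounded below by \<open>m\<close> only because it is taken over a nonempty set: a bump function
  supported in a box inside \<open>G\<close> has positive mass and can be normalised.\<close>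

lemma lambda1_greatest:
  assumes "open G" and "G \<noteq> {}" and "0 < p"
    and "\<And>u. u \<in> test_functions G \<Longrightarrow> p_mass p u = 1 \<Longrightarrow> m \<le> p_energy p u"
  shows "m \<le> lambda1 p G"
  unfolding lambda1_eq
proof (rule cInf_greatest)
  obtain x0 where "x0 \<in> G"
    using assms(2) by auto
  then obtain a b where ab: "cbox a b \<subseteq> G" "x0 \<in> box a b"
    using assms(1) open_contains_cbox by metis
  obtain w where w: "w \<in> test_functions G" "\<And>x. w x \<noteq> 0 \<longleftrightarrow> x \<in> box a b"
    using bump_function[OF ab(1)] by metis
  have "p_mass p w \<noteq> 0"
  proof
    assume "p_mass p w = 0"
    then have "AE x in lborel. \<bar>w x\<bar> powr p = 0"
      unfolding p_mass_def
      by (subst (asm) integral_nonneg_eq_0_iff_AE)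
        (use integrable_test_function_powr[OF w(1) assms(3)] in auto)
    then have "AE x in lborel. x \<notin> box a b"
      by (rule AE_mp) (use w(2) in auto)
    then have null: "emeasure lborel (box a b) = 0"
      by (subst (asm) AE_iff_measurable[where N = "box a b"]) auto
    have less: "a \<bullet> i < b \<bullet> i" if "i \<in> Basis" for i
      using ab(2) that by (force simp: mem_box)
    have "0 < (\<Prod>i\<in>Basis. b \<bullet> i - a \<bullet> i)"
      by (intro prod_pos) (simp add: less)
    then show False
      using null by (simp add: emeasure_lborel_box_eq less_imp_le inner_diff_left less ennreal_eq_0_iff)
  qed
  then obtain c where "p_mass p (\<lambda>x. c * w x) = 1"
    using assms(3) by (rule normalise_p_mass)
  then show "{p_energy p u | u. u \<in> test_functions G \<and> p_mass p u = 1} \<noteq> {}"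
    using test_functions_cmult[OF w(1)] by blast
qed (use assms(4) in auto)

lemma lambda1_nonneg: "open G \<Longrightarrow> G \<noteq> {} \<Longrightarrow> 0 < p \<Longrightarrow> 0 \<le> lambda1 p G"
  by (rule lambda1_greatest) (auto intro: p_energy_nonneg)

section \<open>The whole space\<close>

lemma integral_dilation:
  fixes f :: "'a::euclidean_space \<Rightarrow> real"
  assumes "0 < s" and [measurable]: "f \<in> borel_measurable borel"
  shows "(\<integral>x. f x \<partial>lborel) = s ^ DIM('a) * (\<integral>x. f (s *\<^sub>R x) \<partial>lborel)"
  using assms(1)
  by (subst lborel_affine[of s 0])
    (simp_all add: integral_density integral_distr)

text \<open>Replacing \<open>u(x)\<close> by \<open>u(s x)\<close> multiplies the Rayleigh quotient by \<open>s\<^sup>p\<close>. With \<open>s\<^sup>p = 1/2\<close> it follows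
  that twice the infimum is still a lower bound, so the infimum cannot be positive.\<close>

lemma lambda1_UNIV:
  assumes "0 < p"
  shows "lambda1 p (UNIV :: 'a::euclidean_space set) = 0"
proof (rule antisym)
  let ?L = "lambda1 p (UNIV :: 'a set)"
  show "0 \<le> ?L"
    using assms by (intro lambda1_nonneg) auto
  show "?L \<le> 0"
  proof (rule ccontr)
    assume "\<not> ?L \<le> 0"
    have "2 * ?L \<le> ?L"
    proof (rule lambda1_greatest)
      fix u :: "'a \<Rightarrow> real"
      assume u: "u \<in> test_functions UNIV" and 1: "p_mass p u = 1"
      define s where "s = (1 / 2) powr (1 / p)"
      have s: "0 < s" "s powr p = 1 / 2"
        using assms by (simp_all add: s_def powr_powr)
      let ?us = "\<lambda>x. u (s *\<^sub>R x)"
      have "?L * p_mass p ?us \<le> p_energy p ?us"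
        using s by (intro lambda1_mult_p_mass_le test_functions_dilation u assms) simp
      moreover have "s ^ DIM('a) * p_mass p ?us = 1"
        unfolding 1[symmetric] p_mass_def
        using integrable_test_function_powr[OF u assms]
        by (subst (2) integral_dilation[OF s(1)]) auto
      moreover have "s ^ DIM('a) * p_energy p ?us = p_energy p u / 2"
      proof -
        have "p_energy p ?us = (1 / 2) * (\<integral>x. norm (gradient u (s *\<^sub>R x)) powr p \<partial>lborel)"
          using s by (simp add: p_energy_def gradient_dilation[OF test_functions_C_k[OF u]] powr_mult)
        moreover have "p_energy p u = s ^ DIM('a) * (\<integral>x. norm (gradient u (s *\<^sub>R x)) powr p \<partial>lborel)"
          unfolding p_energy_def using integrable_gradient_powr[OF u assms]
          by (subst integral_dilation[OF s(1)]) auto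
        ultimately show ?thesis
          by simp
      qed
      ultimately show "2 * ?L \<le> p_energy p u"
        using s(1) mult_left_mono[of "?L * p_mass p ?us" "p_energy p ?us" "s ^ DIM('a)"]
        by (simp add: algebra_simps)
    qed (use assms in auto)
    then show False
      using \<open>\<not> ?L \<le> 0\<close> by simp
  qed
qed

section \<open>Products\<close>

text \<open>By Fubini the mass of \<open>u\<close> is the integral over \<open>y\<close> of the masses of the slices \<open>u(\<cdot>, y)\<close>. The
  integral of their energies is the energy of \<open>u\<close> with the gradient replaced by its \<open>x\<close>-part.\<close>

lemma lambda1_le_lambda1_Times:
  assumes G: "open G" "G \<noteq> {}" and H: "open H" "H \<noteq> {}" and p: "0 < p"
  shows "lambda1 p G \<le> lambda1 p (G \<times> H)"
proof (rule lambda1_greatest)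
  fix u :: "'a \<times> 'b \<Rightarrow> real"
  assume u: "u \<in> test_functions (G \<times> H)" and 1: "p_mass p u = 1"
  let ?m = "\<lambda>(x, y). \<bar>u (x, y)\<bar> powr p"
  let ?e = "\<lambda>(x, y). norm (fst (gradient u (x, y))) powr p"
  have P: "lborel \<Otimes>\<^sub>M lborel = (lborel :: ('a \<times> 'b) measure)"
    by (rule lborel_prod)
  have im: "integrable (lborel \<Otimes>\<^sub>M lborel) ?m" and ie: "integrable (lborel \<Otimes>\<^sub>M lborel) ?e"
    using integrable_test_function_powr[OF u p] integrable_linear_gradient_powr[OF u p bounded_linear_fst]
    by (simp_all add: P case_prod_unfold)
  have "lambda1 p G = lambda1 p G * (\<integral>y. (\<integral>x. \<bar>u (x, y)\<bar> powr p \<partial>lborel) \<partial>lborel)"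
    using 1 lborel_pair.integral_snd[OF im] by (simp add: p_mass_def P case_prod_unfold)
  also have "\<dots> = (\<integral>y. lambda1 p G * p_mass p (\<lambda>x. u (x, y)) \<partial>lborel)"
    by (simp add: p_mass_def)
  also have "\<dots> \<le> (\<integral>y. p_energy p (\<lambda>x. u (x, y)) \<partial>lborel)"
  proof (rule integral_mono)
    show "integrable lborel (\<lambda>y. lambda1 p G * p_mass p (\<lambda>x. u (x, y)))"
      using lborel_pair.integrable_snd[OF im] by (simp add: p_mass_def)
    show "integrable lborel (\<lambda>y. p_energy p (\<lambda>x. u (x, y)))"
      using lborel_pair.integrable_snd[OF ie]
      by (simp add: p_energy_def gradient_slice[OF test_functions_C_k[OF u]])
    show "lambda1 p G * p_mass p (\<lambda>x. u (x, y)) \<le> p_energy p (\<lambda>x. u (x, y))" for y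
      by (intro lambda1_mult_p_mass_le test_functions_slice[OF u] p)
  qed
  also have "\<dots> = (\<integral>z. norm (fst (gradient u z)) powr p \<partial>lborel)"
    using lborel_pair.integral_snd[OF ie]
    by (simp add: p_energy_def gradient_slice[OF test_functions_C_k[OF u]] P case_prod_unfold)
  also have "\<dots> \<le> p_energy p u"
    unfolding p_energy_def
  proof (rule integral_mono)
    show "norm (fst (gradient u z)) powr p \<le> norm (gradient u z) powr p" for z
      using p norm_fst_le[of "fst (gradient u z)" "snd (gradient u z)"] by (auto intro!: powr_mono2)
  qed (use integrable_linear_gradient_powr[OF u p bounded_linear_fst] integrable_gradient_powr[OF u p] in auto)
  finally show "lambda1 p G \<le> p_energy p u" .
qed (use assms in \<open>auto intro: open_Times\<close>)

text \<open>Convexity of the \<open>p\<close>-th power applied to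
  \<open>a + b = (1 - t) (a / (1 - t)) + t (b / t)\<close>. It replaces Minkowski's inequality: the factor of
  \<open>a\<^sup>p\<close> can be made as close to 1 as desired, at the cost of a large factor of \<open>b\<^sup>p\<close>.\<close>

lemma powr_sum_le:
  fixes a b t p :: real
  assumes "0 \<le> a" and "0 \<le> b" and "0 < t" and "t < 1" and "1 \<le> p"
  shows "(a + b) powr p \<le> (1 - t) powr (1 - p) * a powr p + t powr (1 - p) * b powr p"
proof -
  have ge_1: "1 \<le> s powr (1 - p)" if "0 < s" "s < 1" for s :: real
    using that assms(5) powr_mono'[of "1 - p" 0 s] by simp
  \<comment> \<open>Convexity is applied on the open half-line, so the boundary cases are separate.\<close>
  consider "a = 0" | "b = 0" | "0 < a" "0 < b"
    using assms by linarith
  then show ?thesis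
  proof cases
    case 1
    then show ?thesis
      using ge_1[of t] assms mult_right_mono[of 1 "t powr (1 - p)" "b powr p"] by simp
  next
    case 2
    then show ?thesis
      using ge_1[of "1 - t"] assms mult_right_mono[of 1 "(1 - t) powr (1 - p)" "a powr p"] by simp
  next
    case 3
    have "((1 - t) *\<^sub>R (a / (1 - t)) + t *\<^sub>R (b / t)) powr p
        \<le> (1 - t) * (a / (1 - t)) powr p + t * (b / t) powr p"
      using assms 3 by (intro convex_onD[OF powr_convex]) auto
    then show ?thesis
      using assms 3 by (simp add: powr_divide powr_diff)
  qed
qed

text \<open>The trial functions are the products \<open>u(x) w(y)\<close> of normalised functions. Their mass is 1 by
  Fubini, and the bound on their energy is linear in the energies of \<open>u\<close> and \<open>w\<close>, so that the two
  infima can be taken one after the other.\<close>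

lemma lambda1_Times_le:
  fixes G :: "'a::euclidean_space set" and H :: "'b::euclidean_space set"
  assumes G: "open G" "G \<noteq> {}" and H: "open H" "H \<noteq> {}" and p: "1 < p" and t: "0 < t" "t < 1"
  shows "lambda1 p (G \<times> H) \<le> (1 - t) powr (1 - p) * lambda1 p G + t powr (1 - p) * lambda1 p H"
    (is "?L \<le> ?A * _ + ?B * _")
proof -
  have le: "?L \<le> ?A * p_energy p u + ?B * p_energy p w"
    if u: "u \<in> test_functions G" "p_mass p u = 1" and w: "w \<in> test_functions H" "p_mass p w = 1" for u w
  proof -
    let ?v = "\<lambda>z. u (fst z) * w (snd z)"
    have v: "?v \<in> test_functions (G \<times> H)"
      using u w by (intro test_functions_tensor)
    note int = integrable_test_function_powr[OF u(1)] integrable_test_function_powr[OF w(1)]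
      integrable_gradient_powr[OF u(1)] integrable_gradient_powr[OF w(1)]
    let ?f = "\<lambda>(x, y). ?A * (norm (gradient u x) powr p * \<bar>w y\<bar> powr p)
      + ?B * (\<bar>u x\<bar> powr p * norm (gradient w y) powr p)"
    have P: "lborel \<Otimes>\<^sub>M lborel = (lborel :: ('a \<times> 'b) measure)"
      by (rule lborel_prod)
    have tensor: "integrable lborel (\<lambda>(x, y). f x * g y)"
      "(\<integral>(x, y). f x * g y \<partial>lborel) = (\<integral>x. f x \<partial>lborel) * (\<integral>y. g y \<partial>lborel)"
      if "integrable lborel f" "integrable lborel g" for f :: "'a \<Rightarrow> real" and g :: "'b \<Rightarrow> real"
    proof -
      have fg: "integrable (lborel \<Otimes>\<^sub>M lborel) (\<lambda>(x, y). f x * g y)"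
      proof (rule lborel_pair.Fubini_integrable)
        note [measurable] = that[THEN borel_measurable_integrable]
        show "(\<lambda>(x, y). f x * g y) \<in> borel_measurable (lborel \<Otimes>\<^sub>M lborel)"
          by measurable
      qed (use that in \<open>simp_all add: abs_mult\<close>)
      show "integrable lborel (\<lambda>(x, y). f x * g y)"
        using fg by (simp add: P)
      show "(\<integral>(x, y). f x * g y \<partial>lborel) = (\<integral>x. f x \<partial>lborel) * (\<integral>y. g y \<partial>lborel)"
        using lborel_pair.integral_fst[OF fg] by (simp add: P)
    qed
    have "?L = ?L * p_mass p ?v"
      using tensor(2)[OF int(1,2)] p u(2) w(2)
      by (simp add: p_mass_def abs_mult powr_mult case_prod_unfold)
    also have "\<dots> \<le> p_energy p ?v"
      using p by (intro lambda1_mult_p_mass_le v) simp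
    also have "\<dots> \<le> (\<integral>z. ?f z \<partial>lborel)"
      unfolding p_energy_def
    proof (rule integral_mono)
      show "integrable lborel (\<lambda>z. norm (gradient ?v z) powr p)"
        using p by (intro integrable_gradient_powr[OF v]) simp
      show "integrable lborel ?f"
        using tensor(1)[OF int(3,2)] tensor(1)[OF int(1,4)] p by (simp add: case_prod_unfold)
      show "norm (gradient ?v z) powr p \<le> ?f z" for z
      proof (cases z)
        case (Pair x y)
        have "norm (gradient ?v z) powr p
            \<le> (\<bar>w y\<bar> * norm (gradient u x) + \<bar>u x\<bar> * norm (gradient w y)) powr p"
          using p norm_Pair_le[of "w y *\<^sub>R gradient u x" "u x *\<^sub>R gradient w y"]
          unfolding Pair gradient_tensor[OF test_functions_C_k[OF u(1)] test_functions_C_k[OF w(1)]]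
          by (intro powr_mono2) auto
        also have "\<dots> \<le> ?f z"
          using powr_sum_le[of "\<bar>w y\<bar> * norm (gradient u x)" "\<bar>u x\<bar> * norm (gradient w y)" t p] p t
          by (simp add: Pair powr_mult mult.commute)
        finally show ?thesis .
      qed
    qed
    also have "\<dots> = ?A * p_energy p u + ?B * p_energy p w"
      using tensor[OF int(3,2)] tensor[OF int(1,4)] p u(2) w(2)
      by (simp add: p_energy_def p_mass_def case_prod_unfold)
    finally show ?thesis .
  qed
  have AB: "0 < ?A" "0 < ?B"
    using t by simp_all
  have "(?L - ?A * p_energy p u) / ?B \<le> lambda1 p H"
    if "u \<in> test_functions G" "p_mass p u = 1" for u
    by (rule lambda1_greatest) (use le[OF that] H p AB in \<open>auto simp: field_simps\<close>)
  then have "?L - ?B * lambda1 p H \<le> ?A * p_energy p u"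
    if "u \<in> test_functions G" "p_mass p u = 1" for u
    using that AB by (force simp: pos_divide_le_eq algebra_simps)
  then have "(?L - ?B * lambda1 p H) / ?A \<le> lambda1 p G"
    using G p AB by (intro lambda1_greatest) (auto simp: pos_divide_le_eq mult.commute)
  then show ?thesis
    using AB by (simp add: pos_divide_le_eq algebra_simps)
qed

theorem lemma5p1:
  fixes p :: real and N M :: nat
    and \<omega> :: "'a::euclidean_space set"
    and \<Omega> :: "('a \<times> 'b::euclidean_space) set"
  assumes "1 < p"
    and "N > M" and "real M > p"
    and "DIM('a) = N - M" and "DIM('b) = M"
    and "domain_set \<omega>"
    and "\<Omega> = \<omega> \<times> (UNIV :: 'b set)"
  shows "lambda1 p \<Omega> = lambda1 p \<omega>"
proof (rule antisym)
  have \<omega>: "open \<omega>" "\<omega> \<noteq> {}"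
    using assms(6) by (simp_all add: domain_set_def)
  show "lambda1 p \<omega> \<le> lambda1 p \<Omega>"
    using \<omega> assms(1) unfolding assms(7) by (intro lambda1_le_lambda1_Times) auto
  have "lambda1 p \<Omega> \<le> (1 - t) powr (1 - p) * lambda1 p \<omega>" if "0 < t" "t < 1" for t
    using lambda1_Times_le[OF \<omega>, of "UNIV :: 'b set" p t] that assms(1)
    by (simp add: assms(7) lambda1_UNIV)
  then have "\<forall>\<^sub>F t in at_right 0. lambda1 p \<Omega> \<le> (1 - t) powr (1 - p) * lambda1 p \<omega>"
    by (auto simp: eventually_at_right_field intro!: exI[of _ 1])
  moreover have "((\<lambda>t. (1 - t) powr (1 - p) * lambda1 p \<omega>) \<longlongrightarrow> (1 - 0) powr (1 - p) * lambda1 p \<omega>)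
      (at_right 0)"
    by (intro tendsto_intros) auto
  ultimately show "lambda1 p \<Omega> \<le> lambda1 p \<omega>"
    using tendsto_lowerbound[of _ _ "at_right (0 :: real)"] by fastforce
qed

end
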